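(* Assume the standing assumptions. Suppose that $\sigma$ is a stopping time (with respect to an admissible filtration) such that $\mathbf P(\sigma>0)>0$, $\mathbf P(S_\sigma\le0)=1$ and $\mathbf E\sigma<\infty$, and such that $$\lim_{x\to\infty}\frac{\mathbf P(M_\sigma>x)}{\overline F(x)}=\mathbf E\sigma.$$ Then $F\in\mathcal S^*$.
   Context: Standing assumptions: $\{\xi_n\}_{n\ge1}$ are i.i.d. real random variables with common distribution function $F$ and finite mean $\mathbf E\xi_1=-m<0$. $F$ is long-tailed: $\overline F(x):=1-F(x)>0$ for all $x$, and $\overline F(x-c)/\overline F(x)\to1$ as $x\to\infty$ for every fixed $c>0$. Notation: $S_0=0$ and $S_n=\sum_{i=1}^n\xi_i$; $M_\sigma=\max_{0\le i\le\sigma}S_i$. Admissible filtration: a stopping time $\sigma$, with values in $\{0,1,\dots\}\cup\{\infty\}$, is taken with respect to a filtration $\{\mathcal F_n\}_{n\ge0}$ such that for each $n$ the variable $\xi_n$ is $\mathcal F_n$-measurable and $\xi_{n+1}$ is independent of $\mathcal F_n$. The class $\mathcal S^*$: a distribution function $G$ on $\mathbb R$ belongs to $\mathcal S^*$ iff $\overline G(x)>0$ for all $x$ and $$\int_0^x\overline G(x-y)\overline G(y)\,dy\sim 2m_{G^+}\overline G(x)\quad(x\to\infty),$$ where $m_{G^+}=\int_0^\infty\overline G(t)\,dt$. *)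

theory Defs
  imports "HOL-Probability.Probability" "HOL-Library.Landau_Symbols"
begin

definition tail :: "(real \<Rightarrow> real) \<Rightarrow> real \<Rightarrow> real" where
  "tail G x = 1 - G x"

definition long_tailed :: "(real \<Rightarrow> real) \<Rightarrow> bool" where
  "long_tailed G \<longleftrightarrow> (\<forall>x. tail G x > 0) \<and>
     (\<forall>c>0. ((\<lambda>x. tail G (x - c) / tail G x) \<longlongrightarrow> 1) at_top)"

definition S_star :: "(real \<Rightarrow> real) \<Rightarrow> bool" where
  "S_star G \<longleftrightarrow> (\<forall>x. tail G x > 0) \<and>
     set_integrable lborel {0..} (tail G) \<and>
     (\<lambda>x. (LBINT y=0..x. tail G (x - y) * tail G y))
        \<sim>[at_top] (\<lambda>x. 2 * (LBINT t:{0..}. tail G t) * tail G x)"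

definition psum :: "(nat \<Rightarrow> 'a \<Rightarrow> real) \<Rightarrow> nat \<Rightarrow> 'a \<Rightarrow> real" where
  "psum \<xi> n \<omega> = (\<Sum>i\<in>{1..n}. \<xi> i \<omega>)"

definition maxsum :: "(nat \<Rightarrow> 'a \<Rightarrow> real) \<Rightarrow> ('a \<Rightarrow> enat) \<Rightarrow> 'a \<Rightarrow> real" where
  "maxsum \<xi> \<sigma> \<omega> = (SUP i\<in>{i. enat i \<le> \<sigma> \<omega>}. psum \<xi> i \<omega>)"

definition admissible_filtration ::
  "'a measure \<Rightarrow> (nat \<Rightarrow> 'a \<Rightarrow> real) \<Rightarrow> (nat \<Rightarrow> 'a set set) \<Rightarrow> bool" where
  "admissible_filtration M \<xi> \<F> \<longleftrightarrow>
     (\<forall>n. sigma_algebra (space M) (\<F> n) \<and> \<F> n \<subseteq> sets M) \<and>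
     (\<forall>n. \<F> n \<subseteq> \<F> (Suc n)) \<and>
     (\<forall>n. \<forall>A\<in>sets borel. \<xi> n -` A \<inter> space M \<in> \<F> n) \<and>
     (\<forall>n. prob_space.indep_set M (\<F> n)
            {\<xi> (Suc n) -` A \<inter> space M | A. A \<in> sets borel})"

definition is_stopping_time ::
  "'a measure \<Rightarrow> (nat \<Rightarrow> 'a set set) \<Rightarrow> ('a \<Rightarrow> enat) \<Rightarrow> bool" where
  "is_stopping_time M \<F> \<sigma> \<longleftrightarrow> (\<forall>n. {\<omega>\<in>space M. \<sigma> \<omega> \<le> enat n} \<in> \<F> n)"

end

theory Submission
  imports Defs
begin

text \<open>
  Write \<open>T\<close> for the tail of \<open>F\<close> and, for \<open>0 \<le> A \<le> x\<close>, let
  \<open>ramp A x u = (\<integral>v\<in>[A, x - A], v < u. T (x - v) dv)\<close>. Stop the walk at \<open>\<sigma>\<close> or at its first passage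
  over \<open>x\<close>, whichever comes first. As \<open>S\<^sub>\<sigma> \<le> 0\<close>, the stopped ramp is nonzero only if \<open>x\<close> is exceeded, and then
  it is at most \<open>\<integral>\<^sub>A\<^sup>\<infinity> T\<close>. By optional stopping this value is the expected sum of the one-step drifts.
  At heights \<open>u \<le> A\<close> the drift is nonnegative, and the step from \<open>0\<close> alone contributes
  \<open>P(\<sigma> > 0)\<close> times the middle part \<open>\<integral>\<^bsub>[A, x - A]\<^esub> T (x - v) T v dv\<close> of the convolution. At heights \<open>u > A\<close> the slope of
  the ramp left of \<open>u\<close> is at most \<open>T (x - u)\<close>, so the drift is at least \<open>- E \<xi>\<^sup>- T (x - u)\<close>; but \<open>T (x - u)\<close>
  is also the probability of jumping over \<open>x\<close> from \<open>u\<close>, and since the jumps from heights in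
  \<open>[-A, A]\<close> already account for nearly \<open>E \<sigma> T x\<close>, the hypothesis \<open>P(M\<^sub>\<sigma> > x) \<sim> E \<sigma> T x\<close> leaves only a small
  multiple of \<open>T x\<close> for the others. Hence the middle part of the convolution is negligible, which for a
  long-tailed \<open>F\<close> is what \<open>\<S>\<^sup>*\<close> amounts to.
\<close>

subsection \<open>Truncated convolutions of a tail\<close>

lemma borel_measurable_antimono:
  fixes f :: "real \<Rightarrow> real"
  assumes "antimono f"
  shows "f \<in> borel_measurable borel"
proof -
  have "mono (\<lambda>x. - f x)" using assms by (auto simp: mono_def antimono_def)
  then have "(\<lambda>x. - (- f x)) \<in> borel_measurable borel"
    by (intro borel_measurable_uminus borel_measurable_mono)
  then show ?thesis by simp
qed

locale bounded_tail =
  fixes T :: "real \<Rightarrow> real"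
  assumes anti: "antimono T"
    and pos: "\<And>x. T x > 0"
    and le1: "\<And>x. T x \<le> 1"
    and int: "set_integrable lborel {0..} T"
begin

lemma measurable_T [measurable]: "T \<in> borel_measurable borel"
  by (rule borel_measurable_antimono[OF anti])

lemma antiD: "x \<le> y \<Longrightarrow> T y \<le> T x"
  using anti by (auto simp: antimono_def)

lemma nonneg [simp]: "0 \<le> T x"
  using pos[of x] by simp

lemma integrable_bounded_interval:
  fixes f :: "real \<Rightarrow> real"
  assumes [measurable]: "f \<in> borel_measurable borel" and "\<And>v. \<bar>f v\<bar> \<le> 1"
  shows "integrable lborel (\<lambda>v. indicator {a..b} v * f v)"
proof (rule Bochner_Integration.integrable_bound)
  show "integrable lborel (\<lambda>v. indicator {a..b} v :: real)"
    by (intro integrable_real_indicator) (auto simp: emeasure_lborel_Icc_eq)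
  show "AE v in lborel. norm (indicator {a..b} v * f v) \<le> norm (indicator {a..b} v :: real)"
    using assms(2) by (auto simp: indicator_def)
qed simp

text \<open>The slope \<open>T (x - v)\<close> at height \<open>v\<close> is chosen so that
  averaging over one step from 0 produces the self-convolution of \<open>T\<close>. The window is a
  separate indicator, so one formula serves every \<open>u\<close>, also when
  \<open>x < 2 * A\<close> and the window is empty.\<close>

definition ramp :: "real \<Rightarrow> real \<Rightarrow> real \<Rightarrow> real" where
  "ramp A x u = (\<integral>v. indicator {A..x-A} v * (indicator {..<u} v * T (x - v)) \<partial>lborel)"

lemma ramp_integrable:
  "integrable lborel (\<lambda>v. indicator {A..x-A} v * (indicator {..<u} v * T (x - v)))"
  by (rule integrable_bounded_interval) (auto simp: indicator_def le1)

lemma ramp_mono: "u \<le> w \<Longrightarrow> ramp A x u \<le> ramp A x w"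
  unfolding ramp_def
  by (intro integral_mono ramp_integrable) (auto simp: indicator_def)

lemma ramp_nonneg: "0 \<le> ramp A x u"
  unfolding ramp_def by (intro integral_nonneg_AE) (auto simp: indicator_def)

lemma ramp_eq_0: "u \<le> A \<Longrightarrow> ramp A x u = 0"
  unfolding ramp_def
  by (intro integral_eq_zero_AE) (auto simp: indicator_def)

lemma measurable_ramp [measurable]: "ramp A x \<in> borel_measurable borel"
  by (intro borel_measurable_mono) (auto simp: mono_def ramp_mono)

text \<open>Only \<open>v\<close> between \<open>u - z\<close> and \<open>u\<close> contribute;
  there \<open>x - v\<close> is at least \<open>x - u\<close>, so monotonicity of \<open>T\<close>
  bounds the slope by its value at \<open>u\<close>. This serves for downward steps of size
  \<open>z\<close>.\<close>

lemma ramp_increment_le: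
  assumes "0 \<le> z"
  shows "ramp A x u - ramp A x (u - z) \<le> z * T (x - u)"
proof -
  have "ramp A x u - ramp A x (u - z) =
      (\<integral>v. indicator {A..x-A} v * (indicator {..<u} v * T (x - v)) -
            indicator {A..x-A} v * (indicator {..<u-z} v * T (x - v)) \<partial>lborel)"
    unfolding ramp_def by (subst Bochner_Integration.integral_diff) (auto intro!: ramp_integrable)
  also have "\<dots> \<le> (\<integral>v. indicator {u-z..u} v * T (x - u) \<partial>lborel)"
  proof (intro integral_mono)
    show "integrable lborel (\<lambda>v. indicator {u-z..u} v * T (x - u))"
      by (rule integrable_bounded_interval) (auto simp: le1)
    show "integrable lborel (\<lambda>v. indicator {A..x-A} v * (indicator {..<u} v * T (x - v)) -
            indicator {A..x-A} v * (indicator {..<u-z} v * T (x - v)))"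
      by (intro Bochner_Integration.integrable_diff ramp_integrable)
  qed (use assms in \<open>auto intro!: antiD simp: indicator_def\<close>)
  also have "\<dots> = z * T (x - u)" using assms by simp
  finally show ?thesis .
qed

section \<open>The integrated tail\<close>

definition int_tail :: "real \<Rightarrow> real" where
  "int_tail A = (LBINT t:{A..}. T t)"

lemma set_integrable_tail: "0 \<le> A \<Longrightarrow> set_integrable lborel {A..} T"
  by (rule set_integrable_subset[OF int]) auto

text \<open>The reflection of \<open>v\<close> to \<open>x - v\<close> maps the window onto itself
  and turns the integrand into \<open>T v\<close>; the window lies to the right of
  \<open>A\<close>.\<close>

lemma ramp_le_int_tail:
  assumes "0 \<le> A"
  shows "ramp A x u \<le> int_tail A"
proof -
  have "ramp A x u \<le> (\<integral>v. indicator {A..x-A} v * T (x - v) \<partial>lborel)"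
    unfolding ramp_def
    by (intro integral_mono ramp_integrable integrable_bounded_interval) (auto simp: indicator_def le1)
  also have "\<dots> = (\<integral>v. indicator {A..x-A} v * T v \<partial>lborel)"
    by (subst lborel_integral_real_affine[where c="-1" and t=x])
       (auto intro!: Bochner_Integration.integral_cong simp: indicator_def)
  also have "\<dots> \<le> int_tail A"
    unfolding int_tail_def set_lebesgue_integral_def
    using set_integrable_tail[OF assms] unfolding set_integrable_def
    by (intro integral_mono integrable_bounded_interval) (auto simp: indicator_def le1)
  finally show ?thesis .
qed

lemma int_tail_split:
  assumes "0 \<le> A"
  shows "int_tail 0 = (LBINT t:{0..<A}. T t) + int_tail A"
proof -
  have "{0..} = {0..<A} \<union> {A..}" using assms by auto
  moreover have "set_integrable lborel {0..<A} T"
    by (rule set_integrable_subset[OF int]) auto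
  moreover have "{0..<A} \<inter> {A..} = {}" by auto
  ultimately show ?thesis unfolding int_tail_def
    using set_integral_Un[of "{0..<A}" "{A..}" lborel T] set_integrable_tail[OF assms] by simp
qed

lemma int_tail_tendsto: "(int_tail \<longlongrightarrow> 0) at_top"
proof -
  have "((\<lambda>A. LBINT t:{0..<A}. T t) \<longlongrightarrow> int_tail 0) at_top"
    unfolding int_tail_def set_lebesgue_integral_def
  proof (rule integral_dominated_convergence_at_top)
    show "integrable lborel (\<lambda>t. indicator {0..} t *\<^sub>R T t)"
      using int unfolding set_integrable_def .
    show "AE t in lborel. ((\<lambda>A. indicator {0..<A} t *\<^sub>R T t) \<longlongrightarrow> indicator {0..} t *\<^sub>R T t) at_top"
    proof (intro AE_I2 tendsto_eventually)
      fix t :: real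
      show "\<forall>\<^sub>F A in at_top. indicator {0..<A} t *\<^sub>R T t = indicator {0..} t *\<^sub>R T t"
        using eventually_gt_at_top[of t] by eventually_elim (auto simp: indicator_def)
    qed
  qed (auto simp: indicator_def)
  then have "((\<lambda>A. int_tail 0 - (LBINT t:{0..<A}. T t)) \<longlongrightarrow> int_tail 0 - int_tail 0) at_top"
    by (intro tendsto_intros)
  moreover have "\<forall>\<^sub>F A in at_top. int_tail 0 - (LBINT t:{0..<A}. T t) = int_tail A"
    using eventually_ge_at_top[of 0] by eventually_elim (simp add: int_tail_split)
  ultimately show ?thesis by (simp add: tendsto_cong)
qed

text \<open>On the unit interval \<open>T\<close> is at least \<open>T 1\<close>. Positivity permits
  the division by \<open>int_tail 0\<close> in the final asymptotic equivalence.\<close>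

lemma int_tail_pos: "0 < int_tail 0"
proof -
  have "0 < (\<integral>v. indicator {0..1::real} v * T 1 \<partial>lborel)" using pos[of 1] by simp
  also have "\<dots> \<le> int_tail 0"
    unfolding int_tail_def set_lebesgue_integral_def
    using int unfolding set_integrable_def
    by (intro integral_mono integrable_bounded_interval) (auto simp: indicator_def le1 antiD)
  finally show ?thesis .
qed

section \<open>The self-convolution: two ends and a middle\<close>

lemma set_integrable_conv: "set_integrable lborel {a..b} (\<lambda>v. T (x - v) * T v)"
  unfolding set_integrable_def real_scaleR_def
  by (rule integrable_bounded_interval) (auto simp: abs_mult intro!: mult_le_one le1)

lemma set_integrable_interval: "set_integrable lborel {a..b} T"
  unfolding set_integrable_def real_scaleR_def
  by (rule integrable_bounded_interval) (auto simp: le1)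

text \<open>The integrand is symmetric under the reflection of \<open>y\<close> to
  \<open>x - y\<close>, so both ends contribute equally; shared endpoints are null sets.\<close>

lemma conv_split:
  assumes "0 \<le> A" "2 * A \<le> x"
  shows "(LBINT y:{0..x}. T (x - y) * T y) =
    2 * (LBINT y:{0..A}. T (x - y) * T y) + (LBINT y:{A..x-A}. T (x - y) * T y)"
proof -
  let ?f = "\<lambda>y. T (x - y) * T y"
  have *: "(LBINT y:{a..c}. ?f y) = (LBINT y:{a..b}. ?f y) + (LBINT y:{b..c}. ?f y)"
    if "a \<le> b" "b \<le> c" for a b c
  proof -
    have "{a..c} = {a..b} \<union> {b..c}" using that by auto
    moreover have "(LBINT y:{a..b} \<union> {b..c}. ?f y) = (LBINT y:{a..b}. ?f y) + (LBINT y:{b..c}. ?f y)"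
      by (rule set_integral_Un_AE)
         (use AE_lborel_singleton[of b] in \<open>auto simp: set_integrable_conv\<close>)
    ultimately show ?thesis by simp
  qed
  have "(LBINT y:{x-A..x}. ?f y) = (LBINT y:{0..A}. ?f y)"
    unfolding set_lebesgue_integral_def
    by (subst lborel_integral_real_affine[where c="-1" and t=x])
       (auto intro!: Bochner_Integration.integral_cong simp: indicator_def mult.commute)
  then show ?thesis
    using *[of 0 A x] *[of A "x-A" x] assms by simp
qed

text \<open>For \<open>y\<close> in \<open>{0..A}\<close> the factor \<open>T (x - y)\<close> lies
  between \<open>T x\<close> and \<open>T (x - A)\<close>, which long-tailedness makes
  asymptotically equal.\<close>

lemma conv_head_tendsto:
  assumes long: "\<And>c. c > 0 \<Longrightarrow> ((\<lambda>x. T (x - c) / T x) \<longlongrightarrow> 1) at_top" and A: "0 < A"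
  shows "((\<lambda>x. (LBINT y:{0..A}. T (x - y) * T y) / T x) \<longlongrightarrow> (LBINT y:{0..A}. T y)) at_top"
proof (rule tendsto_sandwich)
  let ?m = "LBINT y:{0..A}. T y"
  have lower: "T x * ?m \<le> (LBINT y:{0..A}. T (x - y) * T y)" for x
    unfolding set_integral_mult_right[symmetric]
    by (rule set_integral_mono)
       (auto intro!: set_integrable_conv set_integrable_interval mult_right_mono antiD)
  have upper: "(LBINT y:{0..A}. T (x - y) * T y) \<le> T (x - A) * ?m" for x
    unfolding set_integral_mult_right[symmetric]
    by (rule set_integral_mono)
       (auto intro!: set_integrable_conv set_integrable_interval mult_right_mono antiD)
  show "\<forall>\<^sub>F x in at_top. ?m \<le> (LBINT y:{0..A}. T (x - y) * T y) / T x"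
    using lower pos by (auto simp: field_simps)
  show "\<forall>\<^sub>F x in at_top. (LBINT y:{0..A}. T (x - y) * T y) / T x \<le> T (x - A) / T x * ?m"
    using upper pos by (auto simp: divide_right_mono)
  show "((\<lambda>x. T (x - A) / T x * ?m) \<longlongrightarrow> ?m) at_top"
    using tendsto_mult_right[OF long[OF A], of ?m] by simp
qed auto

text \<open>The two ends give twice the integral of \<open>T\<close> up to \<open>A\<close>, which
  differs from \<open>int_tail 0\<close> by \<open>int_tail A\<close>. So \<open>A\<close> is fixed
  first, large enough for \<open>int_tail A\<close> and the middle to be small, and only then does
  \<open>x\<close> grow.\<close>

lemma conv_asymp:
  assumes long: "\<And>c. c > 0 \<Longrightarrow> ((\<lambda>x. T (x - c) / T x) \<longlongrightarrow> 1) at_top"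
    and mid: "\<And>e. e > 0 \<Longrightarrow> \<forall>\<^sub>F A in at_top. \<forall>\<^sub>F x in at_top.
        (LBINT y:{A..x-A}. T (x - y) * T y) \<le> e * T x"
  shows "((\<lambda>x. (LBINT y:{0..x}. T (x - y) * T y) / T x) \<longlongrightarrow> 2 * int_tail 0) at_top"
proof (rule tendstoI)
  \<comment> \<open>Error budget: the head and \<open>int_tail A\<close> enter doubled, hence
    \<open>e / 6\<close> each; the middle enters once, with \<open>e / 3\<close>.\<close>
  fix e :: real assume e: "e > 0"
  have "\<forall>\<^sub>F A in at_top. dist (int_tail A) 0 < e / 6"
    using int_tail_tendsto e by (intro tendstoD) auto
  moreover have "\<forall>\<^sub>F A in at_top. \<forall>\<^sub>F x in at_top.
        (LBINT y:{A..x-A}. T (x - y) * T y) \<le> e / 3 * T x"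
    by (rule mid) (use e in simp)
  ultimately have "\<forall>\<^sub>F A in at_top. A > 0 \<and> dist (int_tail A) 0 < e / 6 \<and> (\<forall>\<^sub>F x in at_top.
        (LBINT y:{A..x-A}. T (x - y) * T y) \<le> e / 3 * T x)"
    using eventually_gt_at_top[of 0] by eventually_elim auto
  then obtain A where A: "A > 0" "dist (int_tail A) 0 < e / 6" and
    midA: "\<forall>\<^sub>F x in at_top. (LBINT y:{A..x-A}. T (x - y) * T y) \<le> e / 3 * T x"
    using eventually_happens trivial_limit_at_top_linorder by blast
  let ?m = "LBINT y:{0..A}. T y"
  have "?m = (LBINT y:{0..<A}. T y)"
    unfolding set_lebesgue_integral_def
    using AE_lborel_singleton[of A]
    by (intro integral_cong_AE) (auto simp: indicator_def elim!: AE_mp)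
  then have m: "int_tail 0 = ?m + int_tail A" using int_tail_split[of A] A by simp
  have "\<forall>\<^sub>F x in at_top. dist ((LBINT y:{0..A}. T (x - y) * T y) / T x) ?m < e / 6"
    using conv_head_tendsto[OF long A(1)] e by (intro tendstoD) auto
  with midA eventually_ge_at_top[of "2 * A"]
  show "\<forall>\<^sub>F x in at_top. dist ((LBINT y:{0..x}. T (x - y) * T y) / T x) (2 * int_tail 0) < e"
  proof eventually_elim
    case (elim x)
    let ?h = "(LBINT y:{0..A}. T (x - y) * T y) / T x"
    let ?r = "(LBINT y:{A..x-A}. T (x - y) * T y) / T x"
    have "(LBINT y:{0..x}. T (x - y) * T y) / T x = 2 * ?h + ?r"
      using conv_split[of A x] A elim by (simp add: add_divide_distrib)
    moreover have "?r \<le> e / 3" using elim(1) pos[of x] by (simp add: field_simps)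
    moreover have "0 \<le> ?r"
      unfolding set_lebesgue_integral_def
      by (intro divide_nonneg_nonneg integral_nonneg_AE) auto
    ultimately show ?case
      using elim(3) A(2) m unfolding dist_real_def by linarith
  qed
qed

end

subsection \<open>The walk and its filtration\<close>

locale stopped_walk = prob_space M
  for M :: "'a measure" +
  fixes \<xi> :: "nat \<Rightarrow> 'a \<Rightarrow> real"
    and F :: "real \<Rightarrow> real" and \<F> :: "nat \<Rightarrow> 'a set set" and \<sigma> :: "'a \<Rightarrow> enat"
  assumes meas [measurable]: "\<And>n. \<xi> n \<in> borel_measurable M"
    and ident: "\<And>n. n \<ge> 1 \<Longrightarrow> distr M borel (\<xi> n) = distr M borel (\<xi> 1)"
    and F_def: "F = cdf (distr M borel (\<xi> 1))"
    and integ: "integrable M (\<xi> 1)"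
    and lt: "long_tailed F"
    and filt: "admissible_filtration M \<xi> \<F>"
    and st: "is_stopping_time M \<F> \<sigma>"
begin

abbreviation T :: "real \<Rightarrow> real" where "T \<equiv> tail F"
abbreviation S :: "nat \<Rightarrow> 'a \<Rightarrow> real" where "S \<equiv> psum \<xi>"

section \<open>The law of a step and its tail\<close>

lemma prob_step_gt:
  assumes "n \<ge> 1"
  shows "prob {\<omega>\<in>space M. y < \<xi> n \<omega>} = T y"
proof -
  interpret D: prob_space "distr M borel (\<xi> 1)" by (rule prob_space_distr) simp
  have "prob {\<omega>\<in>space M. y < \<xi> n \<omega>} = measure (distr M borel (\<xi> n)) {y<..}"
    by (subst measure_distr) (auto intro!: arg_cong[where f=prob])
  also have "\<dots> = measure (distr M borel (\<xi> 1)) (space (distr M borel (\<xi> 1)) - {..y})"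
    using ident[OF assms] by (auto intro!: arg_cong2[where f=measure])
  also have "\<dots> = T y"
    unfolding tail_def F_def cdf_def by (rule D.prob_compl) simp
  finally show ?thesis .
qed

lemma tail_antimono: "antimono T"
  unfolding prob_step_gt[of 1, simplified, symmetric] antimono_def
  by (auto intro!: finite_measure_mono)

lemma measurable_tail [measurable]: "T \<in> borel_measurable borel"
  by (rule borel_measurable_antimono[OF tail_antimono])

text \<open>Tonelli, with \<open>T v\<close> read as the probability that \<open>\<xi> 1\<close>
  exceeds \<open>v\<close>. It yields both the integrability of \<open>T\<close> and the mean of the
  ramp after one step.\<close>

lemma nn_integral_tail:
  assumes [measurable]: "h \<in> borel_measurable borel"
  shows "(\<integral>\<^sup>+v. h v * ennreal (T v) \<partial>lborel) =
    (\<integral>\<^sup>+\<omega>. (\<integral>\<^sup>+v. h v * indicator {..<\<xi> 1 \<omega>} v \<partial>lborel) \<partial>M)"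
proof -
  interpret pair_sigma_finite lborel M ..
  have "(\<integral>\<^sup>+v. h v * ennreal (T v) \<partial>lborel) =
      (\<integral>\<^sup>+v. (\<integral>\<^sup>+\<omega>. h v * indicator {\<omega>\<in>space M. v < \<xi> 1 \<omega>} \<omega> \<partial>M) \<partial>lborel)"
    by (subst nn_integral_cmult_indicator)
       (auto simp: prob_step_gt emeasure_eq_measure)
  \<comment> \<open>The indicator becomes that of a fixed half-plane at
    \<open>(v, \<xi> 1 \<omega>)\<close>, which exposes the joint measurability needed to exchange
    the integrals.\<close>
  also have "\<dots> = (\<integral>\<^sup>+v. (\<integral>\<^sup>+\<omega>. h v * indicator {z. fst z < snd z} (v, \<xi> 1 \<omega>) \<partial>M) \<partial>lborel)"
    by (intro nn_integral_cong) (auto simp: indicator_def)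
  also have "\<dots> = (\<integral>\<^sup>+\<omega>. (\<integral>\<^sup>+v. h v * indicator {z. fst z < snd z} (v, \<xi> 1 \<omega>) \<partial>lborel) \<partial>M)"
  proof (rule Fubini'[symmetric])
    have [measurable]: "{z :: real \<times> real. fst z < snd z} \<in> sets (borel \<Otimes>\<^sub>M borel)"
      unfolding borel_prod by (intro borel_open open_Collect_less continuous_intros)
    show "(\<lambda>(v, \<omega>). h v * indicator {z. fst z < snd z} (v, \<xi> 1 \<omega>)) \<in> borel_measurable (lborel \<Otimes>\<^sub>M M)"
      by measurable
  qed
  also have "\<dots> = (\<integral>\<^sup>+\<omega>. (\<integral>\<^sup>+v. h v * indicator {..<\<xi> 1 \<omega>} v \<partial>lborel) \<partial>M)"
    by (intro nn_integral_cong) (auto simp: indicator_def)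
  finally show ?thesis .
qed

text \<open>With \<open>h\<close> the indicator of the half-line, the integral is the mean of the
  positive part of \<open>\<xi> 1\<close>, at most that of its absolute value.\<close>

lemma set_integrable_tail_nonneg: "set_integrable lborel {0..} T"
  unfolding set_integrable_def
proof (rule integrableI_nonneg)
  have nn: "0 \<le> T v" for v unfolding prob_step_gt[of 1, simplified, symmetric] by simp
  then show "AE v in lborel. 0 \<le> indicator {0..} v *\<^sub>R T v" by auto
  have "(\<integral>\<^sup>+v. ennreal (indicator {0..} v *\<^sub>R T v) \<partial>lborel)
      = (\<integral>\<^sup>+v. indicator {0..} v * ennreal (T v) \<partial>lborel)"
    by (intro nn_integral_cong) (auto simp: indicator_def)
  also have "\<dots> = (\<integral>\<^sup>+\<omega>. (\<integral>\<^sup>+v. indicator {0..} v * indicator {..<\<xi> 1 \<omega>} v \<partial>lborel) \<partial>M)"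
    by (rule nn_integral_tail) simp
  also have "\<dots> = (\<integral>\<^sup>+\<omega>. (\<integral>\<^sup>+v. indicator {0..<\<xi> 1 \<omega>} v \<partial>lborel) \<partial>M)"
    by (intro nn_integral_cong) (auto simp: indicator_def)
  also have "\<dots> \<le> (\<integral>\<^sup>+\<omega>. ennreal (norm (\<xi> 1 \<omega>)) \<partial>M)"
  proof (rule nn_integral_mono)
    fix \<omega>
    show "(\<integral>\<^sup>+v. indicator {0..<\<xi> 1 \<omega>} v \<partial>lborel) \<le> ennreal (norm (\<xi> 1 \<omega>))"
      by (cases "0 \<le> \<xi> 1 \<omega>") auto
  qed
  also have "\<dots> < \<infinity>" using integ unfolding integrable_iff_bounded by simp
  finally show "(\<integral>\<^sup>+v. ennreal (indicator {0..} v *\<^sub>R T v) \<partial>lborel) < \<infinity>" .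
qed simp

sublocale bounded_tail T
proof
  show "0 < T x" for x using lt by (auto simp: long_tailed_def)
  show "T x \<le> 1" for x unfolding prob_step_gt[of 1, simplified, symmetric] by simp
qed (fact tail_antimono set_integrable_tail_nonneg)+

text \<open>The ramp at \<open>u\<close> integrates \<open>T (x - v)\<close> against the indicator
  of \<open>v < u\<close>; averaging over \<open>u = \<xi> 1 \<omega>\<close> replaces that
  indicator by \<open>T v\<close>.\<close>

lemma expectation_ramp:
  "expectation (\<lambda>\<omega>. ramp A x (\<xi> 1 \<omega>)) = (LBINT v:{A..x-A}. T (x - v) * T v)"
proof -
  have "expectation (\<lambda>\<omega>. ramp A x (\<xi> 1 \<omega>)) = enn2real (\<integral>\<^sup>+\<omega>. ennreal (ramp A x (\<xi> 1 \<omega>)) \<partial>M)"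
    by (rule integral_eq_nn_integral) (auto simp: ramp_nonneg)
  also have "(\<integral>\<^sup>+\<omega>. ennreal (ramp A x (\<xi> 1 \<omega>)) \<partial>M) =
     (\<integral>\<^sup>+\<omega>. (\<integral>\<^sup>+v. ennreal (indicator {A..x-A} v * T (x - v)) * indicator {..<\<xi> 1 \<omega>} v \<partial>lborel) \<partial>M)"
  proof (rule nn_integral_cong)
    fix \<omega>
    have "ennreal (ramp A x (\<xi> 1 \<omega>)) =
        (\<integral>\<^sup>+v. ennreal (indicator {A..x-A} v * (indicator {..<\<xi> 1 \<omega>} v * T (x - v))) \<partial>lborel)"
      unfolding ramp_def
      by (rule nn_integral_eq_integral[symmetric]) (auto intro!: ramp_integrable simp del: indicator_simps)
    also have "\<dots> = (\<integral>\<^sup>+v. ennreal (indicator {A..x-A} v * T (x - v)) * indicator {..<\<xi> 1 \<omega>} v \<partial>lborel)"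
      by (intro nn_integral_cong) (auto simp: indicator_def)
    finally show "ennreal (ramp A x (\<xi> 1 \<omega>)) = \<dots>" .
  qed
  also have "\<dots> = (\<integral>\<^sup>+v. ennreal (indicator {A..x-A} v * T (x - v)) * ennreal (T v) \<partial>lborel)"
    by (rule nn_integral_tail[symmetric]) simp
  also have "\<dots> = (\<integral>\<^sup>+v. ennreal (indicator {A..x-A} v *\<^sub>R (T (x - v) * T v)) \<partial>lborel)"
    by (intro nn_integral_cong) (auto simp: indicator_def ennreal_mult)
  also have "enn2real \<dots> = (LBINT v:{A..x-A}. T (x - v) * T v)"
    unfolding set_lebesgue_integral_def
    by (rule integral_eq_nn_integral[symmetric]) auto
  finally show ?thesis .
qed

section \<open>The filtration and the independence of the next step\<close>

lemma sets_filtration: "A \<in> \<F> n \<Longrightarrow> A \<in> events"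
  using filt unfolding admissible_filtration_def by auto

lemma sigma_algebra_filtration: "sigma_algebra (space M) (\<F> n)"
  using filt unfolding admissible_filtration_def by auto

text \<open>Packages \<open>\<F> n\<close> as a measure so that measurability of functions can be
  expressed; only its sets matter.\<close>

definition G :: "nat \<Rightarrow> 'a measure" where "G n = sigma (space M) (\<F> n)"

lemma space_G [simp]: "space (G n) = space M"
  by (simp add: G_def space_measure_of_conv)

lemma sets_G: "sets (G n) = \<F> n"
  unfolding G_def by (rule sigma_algebra.sets_measure_of_eq[OF sigma_algebra_filtration])

lemma filtration_mono: "m \<le> n \<Longrightarrow> \<F> m \<subseteq> \<F> n"
  by (rule lift_Suc_mono_le[of \<F>]) (use filt in \<open>auto simp: admissible_filtration_def\<close>)

lemma step_measurable_G:
  assumes "i \<le> n"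
  shows "\<xi> i \<in> borel_measurable (G n)"
proof (rule measurableI)
  fix A :: "real set" assume "A \<in> sets borel"
  then have "\<xi> i -` A \<inter> space M \<in> \<F> i"
    using filt by (auto simp: admissible_filtration_def)
  then show "\<xi> i -` A \<inter> space (G n) \<in> sets (G n)"
    using filtration_mono[OF assms] by (auto simp: sets_G)
qed auto

lemma walk_measurable_G: "i \<le> n \<Longrightarrow> S i \<in> borel_measurable (G n)"
  unfolding psum_def[abs_def] by (intro borel_measurable_sum step_measurable_G) auto

lemma walk_measurable [measurable]: "S i \<in> borel_measurable M"
  unfolding psum_def[abs_def] by measurable

lemma stop_measurable_G: "{\<omega>\<in>space M. enat n < \<sigma> \<omega>} \<in> sets (G n)"
proof -
  have "{\<omega>\<in>space M. enat n < \<sigma> \<omega>} = space (G n) - {\<omega>\<in>space M. \<sigma> \<omega> \<le> enat n}"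
    by auto
  moreover have "{\<omega>\<in>space M. \<sigma> \<omega> \<le> enat n} \<in> sets (G n)"
    using st by (auto simp: sets_G is_stopping_time_def)
  ultimately show ?thesis by (simp only: sets.compl_sets)
qed

lemma sets_G_events: "A \<in> sets (G n) \<Longrightarrow> A \<in> events"
  by (simp add: sets_G sets_filtration)

lemma stop_gt_event [measurable]: "{\<omega>\<in>space M. enat n < \<sigma> \<omega>} \<in> events"
  using stop_measurable_G sets_G_events by blast

lemma stop_measurable [measurable]: "\<sigma> \<in> measurable M (count_space UNIV)"
proof -
  have le: "{\<omega>\<in>space M. \<sigma> \<omega> \<le> enat n} \<in> events" for n
    using st sets_filtration by (auto simp: is_stopping_time_def)
  have "\<sigma> -` {a} \<inter> space M \<in> events" for a
  proof (cases a)
    case infinity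
    then have "\<sigma> -` {a} \<inter> space M = (\<Inter>n. {\<omega>\<in>space M. enat n < \<sigma> \<omega>})"
      by (auto, metis enat_ord_code(4) less_irrefl not_infinity_eq)
    also have "\<dots> \<in> events" by measurable
    finally show ?thesis .
  next
    case (enat n)
    have "(\<sigma> \<omega> = a) = (\<sigma> \<omega> \<le> enat n \<and> (\<forall>k<n. \<not> \<sigma> \<omega> \<le> enat k))" for \<omega>
      by (cases "\<sigma> \<omega>") (use enat in \<open>auto simp: not_le\<close>, metis le_neq_implies_less less_irrefl)
    then have "\<sigma> -` {a} \<inter> space M =
        {\<omega>\<in>space M. \<sigma> \<omega> \<le> enat n} - (\<Union>k\<in>{..<n}. {\<omega>\<in>space M. \<sigma> \<omega> \<le> enat k})"
      by auto
    also have "\<dots> \<in> events" using le by auto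
    finally show ?thesis .
  qed
  then show ?thesis by (simp add: measurable_count_space_eq_countable)
qed

text \<open>Admissibility gives independence of two families of events, while
  \<open>indep_var\<close> speaks of generated sigma-algebras. The passage works because both
  families are closed under intersection.\<close>

lemma indep_var_step:
  assumes Z: "Z \<in> borel_measurable (G n)"
  shows "indep_var borel (Z :: 'a \<Rightarrow> real) borel (\<xi> (Suc n))"
  unfolding indep_var_eq
proof (intro conjI)
  show "random_variable borel Z"
  proof (rule measurableI)
    fix B :: "real set" assume "B \<in> sets borel"
    from sets_G_events[OF measurable_sets[OF Z this]] show "Z -` B \<inter> space M \<in> events" by simp
  qed simp
  let ?X = "{\<xi> (Suc n) -` A \<inter> space M | A. A \<in> sets borel}"
  have "indep_set (\<F> n) ?X"
    using filt unfolding admissible_filtration_def by blast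
  then have "indep_set (sigma_sets (space M) (\<F> n)) (sigma_sets (space M) ?X)"
  proof (rule indep_set_sigma_sets)
    show "Int_stable (\<F> n)"
      using sigma_algebra_filtration[of n] unfolding Int_stable_def
      by (metis sets.Int sets_G)
    show "Int_stable ?X"
    proof (rule Int_stableI)
      fix a b assume "a \<in> ?X" "b \<in> ?X"
      then obtain A B where "A \<in> sets borel" "B \<in> sets borel"
        "a = \<xi> (Suc n) -` A \<inter> space M" "b = \<xi> (Suc n) -` B \<inter> space M" by auto
      then have "a \<inter> b = \<xi> (Suc n) -` (A \<inter> B) \<inter> space M" "A \<inter> B \<in> sets borel" by auto
      then show "a \<inter> b \<in> ?X" by blast
    qed
  qed
  moreover have "sigma_sets (space M) {Z -` A \<inter> space M | A. A \<in> sets borel} \<subseteq> sigma_sets (space M) (\<F> n)"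
    using measurable_sets[OF Z] by (intro sigma_sets_mono) (auto simp: sets_G)
  ultimately show "indep_set (sigma_sets (space M) {Z -` A \<inter> space M | A. A \<in> sets borel})
      (sigma_sets (space M) ?X)"
    unfolding indep_set_def by (elim indep_sets_mono_sets) (auto split: bool.split)
qed simp

end

subsection \<open>Optional stopping at the first passage\<close>

text \<open>Pathwise optional stopping. The sum telescopes to \<open>g (s k)\<close>, where
  \<open>k\<close> is the first time the path is stopped, or \<open>N\<close>. A nonzero value needs
  \<open>k\<close> to precede \<open>\<tau>\<close>, so either \<open>x\<close> has been exceeded or
  the path was cut off at \<open>N\<close>.\<close>

lemma stopped_sum_le:
  fixes g :: "real \<Rightarrow> real" and s :: "nat \<Rightarrow> real" and \<tau> :: enat
  assumes g0: "\<And>u. u \<le> 0 \<Longrightarrow> g u = 0" and g_le: "\<And>u. g u \<le> c"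
    and s0: "s 0 = 0" and s_stop: "\<And>k. \<tau> = enat k \<Longrightarrow> s k \<le> 0"
  shows "(\<Sum>n<N. of_bool (enat n < \<tau> \<and> (\<forall>i\<le>n. s i \<le> x)) * (g (s (Suc n)) - g (s n)))
    \<le> c * (of_bool (\<exists>i. enat i \<le> \<tau> \<and> x < s i) + of_bool (enat N < \<tau>))"
    (is "?sum N \<le> _")
proof -
  define d where "d n \<longleftrightarrow> enat n < \<tau> \<and> (\<forall>i\<le>n. s i \<le> x)" for n
  have d_anti: "d m" if "d n" "m \<le> n" for m n
    using that le_less_trans[of "enat m" "enat n" \<tau>] by (auto simp: d_def)
  have "\<exists>k\<le>N. ?sum N = g (s k) \<and> (\<forall>i<k. d i) \<and> (k = N \<or> \<not> d k)"
    unfolding d_def[symmetric]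
  proof (induction N)
    case 0
    then show ?case using g0[of "s 0"] s0 by simp
  next
    case (Suc N)
    then obtain k where k: "k \<le> N" "(\<Sum>n<N. of_bool (d n) * (g (s (Suc n)) - g (s n))) = g (s k)"
      "\<forall>i<k. d i" "k = N \<or> \<not> d k" by auto
    show ?case
    proof (cases "d N")
      case True
      then have "k = N" using k d_anti by auto
      then show ?thesis using True k by (intro exI[of _ "Suc N"]) (auto simp: less_Suc_eq)
    next
      case False
      then show ?thesis using k by (intro exI[of _ k]) auto
    qed
  qed
  then obtain k where k: "k \<le> N" "?sum N = g (s k)" "\<forall>i<k. d i" "k = N \<or> \<not> d k" by auto
  have c0: "0 \<le> c" using g_le[of 0] g0[of 0] by simp
  show ?thesis
  proof (cases "enat k < \<tau>")
    case True
    then have "(\<exists>i. enat i \<le> \<tau> \<and> x < s i) \<or> enat N < \<tau>"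
    proof (cases "k = N")
      case False
      then obtain i where "i \<le> k" "x < s i" using k True by (auto simp: d_def not_le)
      then show ?thesis using True le_less_trans[of "enat i" "enat k" \<tau>] less_imp_le by auto
    qed simp
    then show ?thesis using k(2) g_le[of "s k"] c0 by auto
  next
    case False
    \<comment> \<open>If \<open>k\<close> is positive, the path was still running at
      \<open>k - 1\<close>, so \<open>\<tau>\<close> equals \<open>k\<close> exactly; if
      \<open>k\<close> is 0, the starting value decides.\<close>
    have "s k \<le> 0"
    proof (cases k)
      case (Suc m)
      then have "enat m < \<tau>" using k(3) by (auto simp: d_def)
      with False Suc have "\<tau> = enat k" by (cases \<tau>) auto
      then show ?thesis by (rule s_stop)
    qed (simp add: s0)
    then show ?thesis using k(2) g0 c0 by simp
  qed
qed

section \<open>Events of the walk and jumps over a level\<close>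

context stopped_walk
begin

lemma walk_0 [simp]: "S 0 \<omega> = 0"
  by (simp add: psum_def)

lemma walk_Suc: "S (Suc n) \<omega> = S n \<omega> + \<xi> (Suc n) \<omega>"
  by (simp add: psum_def)

definition alive :: "real \<Rightarrow> nat \<Rightarrow> 'a set" where
  "alive x n = {\<omega>\<in>space M. enat n < \<sigma> \<omega> \<and> (\<forall>i\<le>n. S i \<omega> \<le> x)}"

text \<open>Avoids the supremum, which is unspecified on paths that are unbounded above.\<close>

definition exceed :: "real \<Rightarrow> 'a set" where
  "exceed x = {\<omega>\<in>space M. \<exists>i. enat i \<le> \<sigma> \<omega> \<and> x < S i \<omega>}"

text \<open>From a confined path any step above \<open>x + A\<close> crosses \<open>x\<close>,
  wherever in the box the walk stands.\<close>

definition box :: "real \<Rightarrow> nat \<Rightarrow> 'a set" where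
  "box A n = {\<omega>\<in>space M. enat n < \<sigma> \<omega> \<and> (\<forall>i\<le>n. \<bar>S i \<omega>\<bar> \<le> A)}"

definition mean_neg_part :: real where
  "mean_neg_part = expectation (\<lambda>\<omega>. max 0 (- \<xi> 1 \<omega>))"

lemma alive_G: "alive x n \<in> sets (G n)"
proof -
  have "{\<omega>\<in>space (G n). \<forall>i\<in>{..n}. S i \<omega> \<le> x} \<in> sets (G n)"
    using walk_measurable_G
    by (intro sets.sets_Collect_finite_All' borel_measurable_le) auto
  then have "{\<omega>\<in>space M. enat n < \<sigma> \<omega>} \<inter> {\<omega>\<in>space (G n). \<forall>i\<in>{..n}. S i \<omega> \<le> x} \<in> sets (G n)"
    using stop_measurable_G by (rule sets.Int[rotated])
  moreover have "{\<omega>\<in>space M. enat n < \<sigma> \<omega>} \<inter> {\<omega>\<in>space (G n). \<forall>i\<in>{..n}. S i \<omega> \<le> x} = alive x n"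
    by (auto simp: alive_def)
  ultimately show ?thesis by simp
qed

lemma box_G: "box A n \<in> sets (G n)"
proof -
  have "{\<omega>\<in>space (G n). \<forall>i\<in>{..n}. \<bar>S i \<omega>\<bar> \<le> A} \<in> sets (G n)"
    using walk_measurable_G
    by (intro sets.sets_Collect_finite_All' borel_measurable_le borel_measurable_abs) auto
  then have "{\<omega>\<in>space M. enat n < \<sigma> \<omega>} \<inter> {\<omega>\<in>space (G n). \<forall>i\<in>{..n}. \<bar>S i \<omega>\<bar> \<le> A} \<in> sets (G n)"
    using stop_measurable_G by (rule sets.Int[rotated])
  moreover have "{\<omega>\<in>space M. enat n < \<sigma> \<omega>} \<inter> {\<omega>\<in>space (G n). \<forall>i\<in>{..n}. \<bar>S i \<omega>\<bar> \<le> A} = box A n"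
    by (auto simp: box_def)
  ultimately show ?thesis by simp
qed

lemma alive_event [measurable]: "alive x n \<in> events"
  using alive_G sets_G_events by blast

lemma box_event [measurable]: "box A n \<in> events"
  using box_G sets_G_events by blast

lemma exceed_event [measurable]: "exceed x \<in> events"
  unfolding exceed_def by measurable

text \<open>The joint law of \<open>Z\<close> and the next step is a product; its section at
  \<open>z\<close> has probability \<open>T (x - z)\<close> when \<open>A < z\<close> and is empty
  otherwise.\<close>

lemma prob_jump_gt:
  assumes Z: "Z \<in> borel_measurable (G n)"
  shows "prob {\<omega>\<in>space M. A < Z \<omega> \<and> x < Z \<omega> + \<xi> (Suc n) \<omega>} =
    expectation (\<lambda>\<omega>. indicator {A<..} (Z \<omega>) * T (x - Z \<omega>))"
proof -
  have ind: "indep_var borel Z borel (\<xi> (Suc n))" by (rule indep_var_step[OF Z])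
  have Zm [measurable]: "Z \<in> borel_measurable M" by (rule indep_var_rv1[OF ind])
  define B where "B = {z :: real \<times> real. A < fst z \<and> x < fst z + snd z}"
  have "open B"
    unfolding B_def by (intro open_Collect_conj open_Collect_less continuous_intros)
  then have B [measurable]: "B \<in> sets (borel \<Otimes>\<^sub>M borel)"
    using borel_open[of B] by (simp only: borel_prod)
  interpret D: prob_space "distr M borel (\<xi> (Suc n))" by (rule prob_space_distr) simp
  have "ennreal (prob {\<omega>\<in>space M. A < Z \<omega> \<and> x < Z \<omega> + \<xi> (Suc n) \<omega>}) =
      emeasure (distr M (borel \<Otimes>\<^sub>M borel) (\<lambda>\<omega>. (Z \<omega>, \<xi> (Suc n) \<omega>))) B"
    by (subst emeasure_distr[OF _ B])
       (auto simp: B_def emeasure_eq_measure intro!: arg_cong[where f=prob])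
  also have "\<dots> = emeasure (distr M borel Z \<Otimes>\<^sub>M distr M borel (\<xi> (Suc n))) B"
    using ind unfolding indep_var_distribution_eq by simp
  also have "\<dots> = (\<integral>\<^sup>+z. emeasure (distr M borel (\<xi> (Suc n))) (Pair z -` B) \<partial>distr M borel Z)"
    by (rule D.emeasure_pair_measure_alt) (simp add: B)
  also have "\<dots> = (\<integral>\<^sup>+z. ennreal (indicator {A<..} z * T (x - z)) \<partial>distr M borel Z)"
  proof (rule nn_integral_cong)
    fix z
    have "Pair z -` B = (if A < z then {x - z<..} else {})" by (auto simp: B_def)
    moreover have "emeasure (distr M borel (\<xi> (Suc n))) {x - z<..} = ennreal (T (x - z))"
      by (subst emeasure_distr)
         (auto simp: prob_step_gt[of "Suc n" "x - z", symmetric] emeasure_eq_measure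
           intro!: arg_cong[where f=prob])
    ultimately show "emeasure (distr M borel (\<xi> (Suc n))) (Pair z -` B)
        = ennreal (indicator {A<..} z * T (x - z))"
      by auto
  qed
  also have "\<dots> = (\<integral>\<^sup>+\<omega>. ennreal (indicator {A<..} (Z \<omega>) * T (x - Z \<omega>)) \<partial>M)"
    by (subst nn_integral_distr) auto
  finally have eq: "ennreal (prob {\<omega>\<in>space M. A < Z \<omega> \<and> x < Z \<omega> + \<xi> (Suc n) \<omega>}) =
      (\<integral>\<^sup>+\<omega>. ennreal (indicator {A<..} (Z \<omega>) * T (x - Z \<omega>)) \<partial>M)" .
  have "prob {\<omega>\<in>space M. A < Z \<omega> \<and> x < Z \<omega> + \<xi> (Suc n) \<omega>} =
      enn2real (\<integral>\<^sup>+\<omega>. ennreal (indicator {A<..} (Z \<omega>) * T (x - Z \<omega>)) \<partial>M)"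
    unfolding eq[symmetric] by simp
  also have "\<dots> = expectation (\<lambda>\<omega>. indicator {A<..} (Z \<omega>) * T (x - Z \<omega>))"
    by (rule integral_eq_nn_integral[symmetric]) auto
  finally show ?thesis .
qed

lemma neg_part_step:
  "integrable M (\<lambda>\<omega>. max 0 (- \<xi> (Suc n) \<omega>))"
  "expectation (\<lambda>\<omega>. max 0 (- \<xi> (Suc n) \<omega>)) = mean_neg_part"
proof -
  have D: "distr M borel (\<xi> (Suc n)) = distr M borel (\<xi> 1)" by (rule ident) simp
  have "integrable (distr M borel (\<xi> 1)) (\<lambda>y. max 0 (- y))"
    by (subst integrable_distr_eq) (use integ in auto)
  then show "integrable M (\<lambda>\<omega>. max 0 (- \<xi> (Suc n) \<omega>))"
    unfolding D[symmetric] by (subst (asm) integrable_distr_eq) auto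
  have "expectation (\<lambda>\<omega>. max 0 (- \<xi> (Suc n) \<omega>)) = (\<integral>y. max 0 (- y) \<partial>distr M borel (\<xi> (Suc n)))"
    by (subst integral_distr) auto
  also have "\<dots> = mean_neg_part"
    unfolding D mean_neg_part_def by (subst integral_distr) auto
  finally show "expectation (\<lambda>\<omega>. max 0 (- \<xi> (Suc n) \<omega>)) = mean_neg_part" .
qed

lemma mean_neg_part_nonneg: "0 \<le> mean_neg_part"
  unfolding mean_neg_part_def by (intro integral_nonneg_AE) auto

lemma indep_step_integral:
  fixes Z :: "'a \<Rightarrow> real" and f h :: "real \<Rightarrow> real"
  assumes Z: "Z \<in> borel_measurable (G n)"
    and f [measurable]: "f \<in> borel_measurable borel" and f_le: "\<And>z. \<bar>f z\<bar> \<le> (1::real)"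
    and h [measurable]: "h \<in> borel_measurable borel" and h_int: "integrable M (\<lambda>\<omega>. h (\<xi> (Suc n) \<omega>) :: real)"
  shows "integrable M (\<lambda>\<omega>. f (Z \<omega>) * h (\<xi> (Suc n) \<omega>))"
    and "expectation (\<lambda>\<omega>. f (Z \<omega>) * h (\<xi> (Suc n) \<omega>)) =
      expectation (\<lambda>\<omega>. f (Z \<omega>)) * expectation (\<lambda>\<omega>. h (\<xi> (Suc n) \<omega>))"
proof -
  have ind: "indep_var borel Z borel (\<xi> (Suc n))" by (rule indep_var_step[OF Z])
  have [measurable]: "Z \<in> borel_measurable M" by (rule indep_var_rv1[OF ind])
  have ind2: "indep_var borel (\<lambda>\<omega>. f (Z \<omega>)) borel (\<lambda>\<omega>. h (\<xi> (Suc n) \<omega>))"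
    using indep_var_compose[OF ind f h] by (simp add: comp_def)
  have f_int: "integrable M (\<lambda>\<omega>. f (Z \<omega>))"
    by (rule integrable_const_bound[of _ 1]) (auto simp: f_le)
  show "integrable M (\<lambda>\<omega>. f (Z \<omega>) * h (\<xi> (Suc n) \<omega>))"
    by (rule indep_var_integrable[OF ind2 f_int h_int])
  show "expectation (\<lambda>\<omega>. f (Z \<omega>) * h (\<xi> (Suc n) \<omega>)) =
      expectation (\<lambda>\<omega>. f (Z \<omega>)) * expectation (\<lambda>\<omega>. h (\<xi> (Suc n) \<omega>))"
    by (rule indep_var_lebesgue_integral[OF ind2 f_int h_int])
qed

lemma prob_box_jump: "prob (box A n \<inter> {\<omega>\<in>space M. y < \<xi> (Suc n) \<omega>}) = prob (box A n) * T y"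
proof -
  have "indep_set (\<F> n) {\<xi> (Suc n) -` A \<inter> space M | A. A \<in> sets borel}"
    using filt unfolding admissible_filtration_def by blast
  moreover have "box A n \<in> \<F> n" using box_G by (simp add: sets_G)
  moreover have "{\<omega>\<in>space M. y < \<xi> (Suc n) \<omega>} \<in> {\<xi> (Suc n) -` A \<inter> space M | A. A \<in> sets borel}"
    by (auto intro!: exI[of _ "{y<..}"])
  ultimately have "prob (box A n \<inter> {\<omega>\<in>space M. y < \<xi> (Suc n) \<omega>}) =
      prob (box A n) * prob {\<omega>\<in>space M. y < \<xi> (Suc n) \<omega>}"
    by (rule indep_setD)
  then show ?thesis by (simp add: prob_step_gt)
qed

end

section \<open>Drift of the stopped ramp against jumps over the level\<close>

locale returning_walk = stopped_walk +
  assumes stop_le_0: "AE \<omega> in M. \<forall>k. \<sigma> \<omega> = enat k \<longrightarrow> S k \<omega> \<le> 0"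
begin

text \<open>The default \<open>A\<close> is just excluded by the indicator of \<open>{A<..}\<close>,
  so stopped paths drop out. This gives a single variable known at time \<open>n\<close>, to which
  independence of the next step applies.\<close>

definition alive_pos :: "real \<Rightarrow> real \<Rightarrow> nat \<Rightarrow> 'a \<Rightarrow> real" where
  "alive_pos A x n \<omega> = (if \<omega> \<in> alive x n then S n \<omega> else A)"

lemma alive_pos_measurable: "alive_pos A x n \<in> borel_measurable (G n)"
proof -
  have "{\<omega>\<in>space (G n). \<omega> \<in> alive x n} = alive x n" by (auto simp: alive_def)
  then show ?thesis
    unfolding alive_pos_def[abs_def]
    by (intro measurable_If walk_measurable_G) (simp_all add: alive_G)
qed

text \<open>By \<open>prob_jump_gt\<close> this is the probability that the walk, alive at time
  \<open>n\<close> above \<open>A\<close>, crosses \<open>x\<close> with its next step.\<close>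

definition occ :: "real \<Rightarrow> real \<Rightarrow> nat \<Rightarrow> real" where
  "occ A x n = expectation (\<lambda>\<omega>. indicator {A<..} (alive_pos A x n \<omega>) * T (x - alive_pos A x n \<omega>))"

lemma occ_nonneg: "0 \<le> occ A x n"
  unfolding occ_def by (intro integral_nonneg_AE) auto

text \<open>First passages over \<open>x\<close> at different times are disjoint parts of
  \<open>exceed x\<close>. Each contains two disjoint kinds: from above \<open>A\<close>
  (\<open>U\<close>), and from the box by a step above \<open>x + A\<close> (\<open>V\<close>).
  Since \<open>A \<le> x\<close>, box paths have not yet passed \<open>x\<close>.\<close>

lemma sum_occ_le:
  assumes A: "0 \<le> A" "A \<le> x"
  shows "(\<Sum>n<N. occ A x n) + (\<Sum>n<N. prob (box A n)) * T (x + A) \<le> prob (exceed x)"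
proof -
  define U where "U n = {\<omega>\<in>space M. A < alive_pos A x n \<omega> \<and> x < alive_pos A x n \<omega> + \<xi> (Suc n) \<omega>}" for n
  define V where "V n = box A n \<inter> {\<omega>\<in>space M. x + A < \<xi> (Suc n) \<omega>}" for n
  define W where "W n = alive x n \<inter> {\<omega>\<in>space M. x < S (Suc n) \<omega>}" for n
  have [measurable]: "alive_pos A x n \<in> borel_measurable M" for n
    using indep_var_rv1[OF indep_var_step[OF alive_pos_measurable]] .
  have [measurable]: "U n \<in> events" "V n \<in> events" "W n \<in> events" for n
    unfolding U_def V_def W_def by measurable
  have "U n \<subseteq> W n" for n
    by (auto simp: U_def W_def alive_pos_def walk_Suc split: if_splits)
  moreover have "V n \<subseteq> W n" for n
  proof
    fix \<omega> assume "\<omega> \<in> V n"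
    then have *: "\<omega> \<in> space M" "enat n < \<sigma> \<omega>" "\<And>i. i \<le> n \<Longrightarrow> \<bar>S i \<omega>\<bar> \<le> A" "x + A < \<xi> (Suc n) \<omega>"
      by (auto simp: V_def box_def)
    have "S i \<omega> \<le> x" if "i \<le> n" for i using *(3)[OF that] A by linarith
    moreover have "x < S (Suc n) \<omega>" using *(3)[of n] *(4) unfolding walk_Suc by linarith
    ultimately show "\<omega> \<in> W n" using *(1,2) by (simp add: W_def alive_def)
  qed
  \<comment> \<open>\<open>U\<close> needs a height above \<open>A\<close> at time \<open>n\<close>,
    \<open>V\<close> one of at most \<open>A\<close>.\<close>
  moreover have "U n \<inter> V n = {}" for n
    by (auto simp: U_def V_def box_def alive_pos_def split: if_splits)
  ultimately have "prob (U n) + prob (V n) \<le> prob (W n)" for n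
    by (subst finite_measure_Union[symmetric]) (auto intro!: finite_measure_mono)
  then have "(\<Sum>n<N. prob (U n) + prob (V n)) \<le> (\<Sum>n<N. prob (W n))"
    by (rule sum_mono)
  also have "\<dots> = prob (\<Union>n<N. W n)"
  proof (rule finite_measure_finite_Union[symmetric])
    \<comment> \<open>A path in \<open>W m\<close> is above \<open>x\<close> at time
      \<open>Suc m\<close>, which is too early for one still alive at \<open>n\<close>.\<close>
    have "W m \<inter> W n = {}" if "m < n" for m n
      using Suc_leI[OF that] by (auto simp: W_def alive_def not_less[symmetric])
    then show "disjoint_family_on W {..<N}"
      unfolding disjoint_family_on_def by (metis inf_commute linorder_neqE_nat)
  qed auto
  also have "\<dots> \<le> prob (exceed x)"
  proof (rule finite_measure_mono)
    have "enat (Suc n) \<le> \<sigma> \<omega>" if "enat n < \<sigma> \<omega>" for n \<omega>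
      using that by (simp add: Suc_ile_eq)
    then show "(\<Union>n<N. W n) \<subseteq> exceed x"
      by (auto simp: W_def alive_def exceed_def)
  qed simp
  also have "(\<Sum>n<N. prob (U n) + prob (V n)) = (\<Sum>n<N. occ A x n) + (\<Sum>n<N. prob (box A n)) * T (x + A)"
    unfolding U_def V_def occ_def
    by (simp add: prob_jump_gt[OF alive_pos_measurable] prob_box_jump sum.distrib sum_distrib_right)
  finally show ?thesis .
qed

definition ramp_step :: "real \<Rightarrow> real \<Rightarrow> nat \<Rightarrow> 'a \<Rightarrow> real" where
  "ramp_step A x n \<omega> = indicator (alive x n) \<omega> * (ramp A x (S (Suc n) \<omega>) - ramp A x (S n \<omega>))"

text \<open>Upward steps never lower the ramp, and downward ones are controlled by
  \<open>ramp_increment_le\<close>. From heights up to \<open>A\<close> the ramp starts at 0 and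
  cannot drop.\<close>

lemma ramp_step_ge:
  "- (indicator {A<..} (alive_pos A x n \<omega>) * T (x - alive_pos A x n \<omega>)) * max 0 (- \<xi> (Suc n) \<omega>)
    \<le> ramp_step A x n \<omega>"
proof (cases "\<omega> \<in> alive x n \<and> A < S n \<omega>")
  case True
  let ?z = "max 0 (- \<xi> (Suc n) \<omega>)"
  have "ramp A x (S n \<omega>) - ramp A x (S n \<omega> - ?z) \<le> ?z * T (x - S n \<omega>)"
    by (rule ramp_increment_le) simp
  moreover have "ramp A x (S n \<omega> - ?z) \<le> ramp A x (S (Suc n) \<omega>)"
    by (rule ramp_mono) (simp add: walk_Suc)
  ultimately show ?thesis using True
    by (simp add: ramp_step_def alive_pos_def mult.commute)
next
  case False
  then show ?thesis
    by (auto simp: ramp_step_def alive_pos_def ramp_eq_0 ramp_nonneg)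
qed

lemma integrable_ramp:
  assumes [measurable]: "Y \<in> borel_measurable M" and "0 \<le> A"
  shows "integrable M (\<lambda>\<omega>. ramp A x (Y \<omega>))"
  by (rule integrable_const_bound[of _ "int_tail A"])
     (auto simp: ramp_nonneg ramp_le_int_tail assms)

lemma integrable_ramp_step: "0 \<le> A \<Longrightarrow> integrable M (ramp_step A x n)"
  unfolding ramp_step_def[abs_def] real_scaleR_def[symmetric]
  by (rule integrable_mult_indicator[OF alive_event])
     (intro Bochner_Integration.integrable_diff integrable_ramp walk_measurable)

text \<open>The negative part of the next step is independent of \<open>alive_pos\<close>, so the
  mean of the pathwise lower bound factorises.\<close>

lemma expectation_ramp_step_ge:
  assumes "0 \<le> A"
  shows "- occ A x n * mean_neg_part \<le> expectation (ramp_step A x n)"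
proof -
  let ?f = "\<lambda>z. - (indicator {A<..} z * T (x - z))"
  have f: "\<bar>?f z\<bar> \<le> 1" for z by (auto simp: indicator_def le1)
  note * = indep_step_integral[OF alive_pos_measurable, of ?f "\<lambda>y. max 0 (- y)", OF _ f _ neg_part_step(1)]
  have "- occ A x n * mean_neg_part =
      expectation (\<lambda>\<omega>. ?f (alive_pos A x n \<omega>) * max 0 (- \<xi> (Suc n) \<omega>))"
    by (subst *(2)) (auto simp: neg_part_step(2) occ_def)
  also have "\<dots> \<le> expectation (ramp_step A x n)"
    by (rule integral_mono[OF *(1) integrable_ramp_step[OF assms] ramp_step_ge]) auto
  finally show ?thesis .
qed

text \<open>The ramp vanishes at the start 0, so only its value after the first step counts; that
  step is independent of the event that \<open>\<sigma>\<close> is positive, which is decided at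
  time 0.\<close>

lemma expectation_ramp_step_0:
  assumes "0 \<le> A" "0 \<le> x"
  shows "expectation (ramp_step A x 0) =
    prob {\<omega>\<in>space M. 0 < \<sigma> \<omega>} * (LBINT v:{A..x-A}. T (x - v) * T v)"
proof -
  let ?E = "{\<omega>\<in>space M. enat 0 < \<sigma> \<omega>}"
  have m: "(\<lambda>\<omega>. indicator ?E \<omega> :: real) \<in> borel_measurable (G 0)"
    using stop_measurable_G by (intro borel_measurable_indicator)
  \<comment> \<open>\<open>indep_step_integral\<close> wants a function bounded by 1 on all reals;
    this clamp is one that fixes the values 0 and 1 of the indicator.\<close>
  have f: "\<bar>max 0 (min 1 z)\<bar> \<le> 1" for z :: real by auto
  have h: "integrable M (\<lambda>\<omega>. ramp A x (\<xi> (Suc 0) \<omega>))" by (rule integrable_ramp) (auto simp: assms)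
  note * = indep_step_integral[OF m, of "\<lambda>z. max 0 (min 1 z)" "ramp A x", OF _ f _ h]
  have "expectation (ramp_step A x 0) =
      expectation (\<lambda>\<omega>. max 0 (min 1 (indicator ?E \<omega> :: real)) * ramp A x (\<xi> (Suc 0) \<omega>))"
    using assms
    by (intro Bochner_Integration.integral_cong)
       (auto simp: ramp_step_def alive_def walk_Suc ramp_eq_0 indicator_def)
  also have "\<dots> = expectation (\<lambda>\<omega>. max 0 (min 1 (indicator ?E \<omega> :: real))) * expectation (\<lambda>\<omega>. ramp A x (\<xi> (Suc 0) \<omega>))"
    by (rule *(2)) auto
  also have "expectation (\<lambda>\<omega>. max 0 (min 1 (indicator ?E \<omega> :: real))) = expectation (indicator ?E)"
    by (intro Bochner_Integration.integral_cong) (auto simp: indicator_def)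
  also have "expectation (\<lambda>\<omega>. ramp A x (\<xi> (Suc 0) \<omega>)) = (LBINT v:{A..x-A}. T (x - v) * T v)"
    using expectation_ramp[of A x] by simp
  finally show ?thesis by (simp add: zero_enat_def)
qed

text \<open>\<open>stopped_sum_le\<close> with \<open>g\<close> the ramp and
  \<open>c = int_tail A\<close>, averaged; the last probability is the price of truncating at time
  \<open>N\<close>.\<close>

lemma sum_ramp_step_le:
  assumes A: "0 \<le> A"
  shows "expectation (\<lambda>\<omega>. \<Sum>n<N. ramp_step A x n \<omega>) \<le>
    int_tail A * (prob (exceed x) + prob {\<omega>\<in>space M. enat N < \<sigma> \<omega>})"
proof -
  have "expectation (\<lambda>\<omega>. \<Sum>n<N. ramp_step A x n \<omega>) \<le>
      expectation (\<lambda>\<omega>. int_tail A * (indicator (exceed x) \<omega> + indicator {\<omega>\<in>space M. enat N < \<sigma> \<omega>} \<omega>))"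
  proof (rule integral_mono_AE)
    show "AE \<omega> in M. (\<Sum>n<N. ramp_step A x n \<omega>) \<le>
        int_tail A * (indicator (exceed x) \<omega> + indicator {\<omega>\<in>space M. enat N < \<sigma> \<omega>} \<omega>)"
      using stop_le_0 AE_space
    proof eventually_elim
      case (elim \<omega>)
      have "(\<Sum>n<N. of_bool (enat n < \<sigma> \<omega> \<and> (\<forall>i\<le>n. S i \<omega> \<le> x)) * (ramp A x (S (Suc n) \<omega>) - ramp A x (S n \<omega>)))
        \<le> int_tail A * (of_bool (\<exists>i. enat i \<le> \<sigma> \<omega> \<and> x < S i \<omega>) + of_bool (enat N < \<sigma> \<omega>))"
        by (rule stopped_sum_le) (use A elim in \<open>auto simp: ramp_eq_0 ramp_le_int_tail\<close>)
      then show ?case using elim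
        by (simp add: ramp_step_def alive_def exceed_def indicator_def)
    qed
    show "integrable M (\<lambda>\<omega>. int_tail A * (indicator (exceed x) \<omega> + indicator {\<omega>\<in>space M. enat N < \<sigma> \<omega>} \<omega>))"
      by (intro integrable_mult_right Bochner_Integration.integrable_add integrable_real_indicator)
         (auto simp: emeasure_eq_measure)
  qed (intro Bochner_Integration.integrable_sum integrable_ramp_step A)
  also have "\<dots> = int_tail A * (prob (exceed x) + prob {\<omega>\<in>space M. enat N < \<sigma> \<omega>})"
    by (subst integral_mult_right_zero, subst Bochner_Integration.integral_add)
       (auto simp: emeasure_eq_measure)
  finally show ?thesis .
qed

text \<open>Lower and upper bounds for the mean of the stopped ramp are compared, and
  \<open>sum_occ_le\<close> removes the \<open>occ\<close> terms. The box count \<open>K\<close> is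
  separate from the horizon \<open>N\<close>, so that \<open>N\<close> can tend to infinity with
  \<open>K\<close> fixed.\<close>

lemma conv_mid_le_aux:
  assumes A: "0 \<le> A" "A \<le> x" and N: "0 < N" "K \<le> N"
  shows "prob {\<omega>\<in>space M. 0 < \<sigma> \<omega>} * (LBINT v:{A..x-A}. T (x - v) * T v) \<le>
    int_tail A * (prob (exceed x) + prob {\<omega>\<in>space M. enat N < \<sigma> \<omega>}) +
    mean_neg_part * (prob (exceed x) - (\<Sum>n<K. prob (box A n)) * T (x + A))"
    (is "?R \<le> ?L + _")
proof -
  \<comment> \<open>Time 0 carries the convolution term; subtracting \<open>occ A x 0\<close> there
    as well only weakens the bound and keeps one formula for all times.\<close>
  have "?R - (\<Sum>n<N. occ A x n) * mean_neg_part =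
      (\<Sum>n<N. (if n = 0 then ?R else 0) - occ A x n * mean_neg_part)"
    unfolding sum_subtractf using N by (simp add: sum_distrib_right sum.delta)
  also have "\<dots> \<le> (\<Sum>n<N. expectation (ramp_step A x n))"
  proof (rule sum_mono)
    fix n
    show "(if n = 0 then ?R else 0) - occ A x n * mean_neg_part \<le> expectation (ramp_step A x n)"
      using expectation_ramp_step_0[of A x] expectation_ramp_step_ge[of A x n] A
        mult_nonneg_nonneg[OF occ_nonneg mean_neg_part_nonneg, of A x n]
      by (cases "n = 0") auto
  qed
  also have "\<dots> = expectation (\<lambda>\<omega>. \<Sum>n<N. ramp_step A x n \<omega>)"
    using A by (intro Bochner_Integration.integral_sum[symmetric] integrable_ramp_step)
  also have "\<dots> \<le> ?L" by (rule sum_ramp_step_le[OF A(1)])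
  finally have 1: "?R \<le> ?L + mean_neg_part * (\<Sum>n<N. occ A x n)" by (simp add: mult.commute)
  have "(\<Sum>n<K. prob (box A n)) \<le> (\<Sum>n<N. prob (box A n))"
    using N by (intro sum_mono2) auto
  then have "(\<Sum>n<K. prob (box A n)) * T (x + A) \<le> (\<Sum>n<N. prob (box A n)) * T (x + A)"
    by (rule mult_right_mono) simp
  then have "(\<Sum>n<N. occ A x n) \<le> prob (exceed x) - (\<Sum>n<K. prob (box A n)) * T (x + A)"
    using sum_occ_le[OF A, of N] by linarith
  from mult_left_mono[OF this mean_neg_part_nonneg] 1 show ?thesis by linarith
qed

end

subsection \<open>Asymptotics\<close>

context stopped_walk
begin

text \<open>Paths with infinite \<open>\<sigma>\<close> may be unbounded above, but there the
  supremum is one fixed value. Natural number bounds \<open>K\<close> make the case distinction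
  countable, hence measurable.\<close>

lemma maxsum_gt_event: "{\<omega>\<in>space M. x < maxsum \<xi> \<sigma> \<omega>} \<in> events"
proof -
  let ?bdd = "\<lambda>\<omega>. \<exists>K::nat. \<forall>i. enat i \<le> \<sigma> \<omega> \<longrightarrow> S i \<omega> \<le> real K"
  \<comment> \<open>the unspecified value of \<open>Sup\<close> on a real set that is not bounded above\<close>
  let ?junk = "LEAST z::real. False"
  have "(x < maxsum \<xi> \<sigma> \<omega>) =
      (if ?bdd \<omega> then \<exists>i. enat i \<le> \<sigma> \<omega> \<and> x < S i \<omega> else x < ?junk)" for \<omega>
  proof -
    let ?X = "(\<lambda>i. S i \<omega>) ` {i. enat i \<le> \<sigma> \<omega>}"
    have ne: "0 \<in> {i. enat i \<le> \<sigma> \<omega>}" by (simp add: zero_enat_def[symmetric])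
    show ?thesis
    proof (cases "?bdd \<omega>")
      case True
      then obtain K :: nat where "\<forall>i. enat i \<le> \<sigma> \<omega> \<longrightarrow> S i \<omega> \<le> real K" by blast
      then have "bdd_above ?X" by (intro bdd_aboveI2[where M="real K"]) auto
      then have "(x < maxsum \<xi> \<sigma> \<omega>) = (\<exists>i\<in>{i. enat i \<le> \<sigma> \<omega>}. x < S i \<omega>)"
        unfolding maxsum_def using ne by (intro less_cSUP_iff) auto
      then show ?thesis using True by auto
    next
      case False
      have "(\<forall>y\<in>?X. y \<le> z) = False" for z
      proof -
        obtain K :: nat where "z \<le> real K" using real_arch_simple by blast
        moreover obtain i where "enat i \<le> \<sigma> \<omega>" "\<not> S i \<omega> \<le> real K" using False by blast
        ultimately show ?thesis by force
      qed
      then have "(\<lambda>z. \<forall>y\<in>?X. y \<le> z) = (\<lambda>_. False)" by (rule ext)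
      then have "maxsum \<xi> \<sigma> \<omega> = ?junk"
        unfolding maxsum_def Sup_real_def by (rule arg_cong)
      then show ?thesis by (simp only: False if_False)
    qed
  qed
  then have "{\<omega>\<in>space M. x < maxsum \<xi> \<sigma> \<omega>} =
      {\<omega>\<in>space M. if ?bdd \<omega> then \<exists>i. enat i \<le> \<sigma> \<omega> \<and> x < S i \<omega> else x < ?junk}"
    by simp
  also have "\<dots> \<in> events" by measurable
  finally show ?thesis .
qed

lemma prob_maxsum_gt:
  assumes fin: "AE \<omega> in M. \<sigma> \<omega> \<noteq> \<infinity>"
  shows "prob {\<omega>\<in>space M. x < maxsum \<xi> \<sigma> \<omega>} = prob (exceed x)"
proof (rule measure_eq_AE)
  show "AE \<omega> in M. (\<omega> \<in> {\<omega>\<in>space M. x < maxsum \<xi> \<sigma> \<omega>}) = (\<omega> \<in> exceed x)"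
    using fin
  proof eventually_elim
    case (elim \<omega>)
    then obtain k where k: "\<sigma> \<omega> = enat k" by auto
    then have "{i. enat i \<le> \<sigma> \<omega>} = {..k}" by auto
    then have "x < maxsum \<xi> \<sigma> \<omega> \<longleftrightarrow> (\<exists>i\<le>k. x < S i \<omega>)"
      unfolding maxsum_def by (simp add: less_cSUP_iff Bex_def)
    then show ?case using k by (auto simp: exceed_def)
  qed
qed (simp_all add: maxsum_gt_event)

text \<open>Continuity from below: finitely many partial sums always fit into some box.\<close>

lemma prob_box_tendsto: "(\<lambda>k. prob (box (real k) n)) \<longlonglongrightarrow> prob {\<omega>\<in>space M. enat n < \<sigma> \<omega>}"
proof -
  have "(\<Union>k. box (real k) n) = {\<omega>\<in>space M. enat n < \<sigma> \<omega>}"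
  proof safe
    fix \<omega> assume *: "\<omega> \<in> space M" "enat n < \<sigma> \<omega>"
    obtain k :: nat where "Max ((\<lambda>i. \<bar>S i \<omega>\<bar>) ` {..n}) \<le> real k" using real_arch_simple by blast
    then have "\<omega> \<in> box (real k) n" using * by (auto simp: box_def)
    then show "\<omega> \<in> (\<Union>k. box (real k) n)" by blast
  qed (auto simp: box_def)
  moreover have "(\<lambda>k. prob (box (real k) n)) \<longlonglongrightarrow> prob (\<Union>k. box (real k) n)"
    by (rule finite_Lim_measure_incseq) (force simp: incseq_def box_def)+
  ultimately show ?thesis by simp
qed

lemma box_mono: "A \<le> B \<Longrightarrow> box A n \<subseteq> box B n"
  by (force simp: box_def)

end

locale finite_mean_walk = returning_walk +
  assumes finite_mean: "(\<integral>\<^sup>+\<omega>. ennreal_of_enat (\<sigma> \<omega>) \<partial>M) < \<infinity>"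
begin

abbreviation mean_stop :: real where
  "mean_stop \<equiv> enn2real (\<integral>\<^sup>+\<omega>. ennreal_of_enat (\<sigma> \<omega>) \<partial>M)"

lemma mean_stop_sums: "(\<lambda>n. prob {\<omega>\<in>space M. enat n < \<sigma> \<omega>}) sums mean_stop"
proof -
  let ?p = "\<lambda>n. prob {\<omega>\<in>space M. enat n < \<sigma> \<omega>}"
  have eq: "(\<integral>\<^sup>+\<omega>. ennreal_of_enat (\<sigma> \<omega>) \<partial>M) = (\<Sum>n. ennreal (?p n))"
    by (subst nn_integral_enat_function) (auto simp: emeasure_eq_measure)
  then have s: "summable ?p"
    using finite_mean by (intro summable_suminf_not_top) auto
  then have "mean_stop = suminf ?p"
    unfolding eq by (subst suminf_ennreal2) (auto simp: suminf_nonneg)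
  then show ?thesis using s by (simp add: summable_sums)
qed

text \<open>As \<open>N\<close> grows in \<open>conv_mid_le_aux\<close>, the probability of
  \<open>N < \<sigma>\<close> vanishes, being a term of the convergent series for
  \<open>mean_stop\<close>.\<close>

lemma conv_mid_le:
  assumes A: "0 \<le> A" "A \<le> x"
  shows "prob {\<omega>\<in>space M. 0 < \<sigma> \<omega>} * (LBINT v:{A..x-A}. T (x - v) * T v) \<le>
    int_tail A * prob (exceed x) +
    mean_neg_part * (prob (exceed x) - (\<Sum>n<K. prob (box A n)) * T (x + A))"
    (is "?L \<le> ?R")
proof -
  have "(\<lambda>N. int_tail A * (prob (exceed x) + prob {\<omega>\<in>space M. enat N < \<sigma> \<omega>}) +
    mean_neg_part * (prob (exceed x) - (\<Sum>n<K. prob (box A n)) * T (x + A)))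
    \<longlonglongrightarrow> int_tail A * (prob (exceed x) + 0) +
    mean_neg_part * (prob (exceed x) - (\<Sum>n<K. prob (box A n)) * T (x + A))"
    by (intro tendsto_intros summable_LIMSEQ_zero sums_summable[OF mean_stop_sums])
  moreover have "\<forall>N\<ge>Suc K. ?L \<le> int_tail A * (prob (exceed x) + prob {\<omega>\<in>space M. enat N < \<sigma> \<omega>}) +
    mean_neg_part * (prob (exceed x) - (\<Sum>n<K. prob (box A n)) * T (x + A))"
    using A by (intro allI impI conv_mid_le_aux) auto
  ultimately have "?L \<le> int_tail A * (prob (exceed x) + 0) +
    mean_neg_part * (prob (exceed x) - (\<Sum>n<K. prob (box A n)) * T (x + A))"
    by (intro LIMSEQ_le_const) blast+
  then show ?thesis by simp
qed

text \<open>First \<open>K\<close> is taken so that the series for \<open>mean_stop\<close> is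
  nearly exhausted, then a box large enough for these \<open>K\<close> times; larger boxes only
  help.\<close>

lemma eventually_box_mass:
  assumes "0 < e"
  shows "\<exists>K. \<forall>\<^sub>F A in at_top. mean_stop - e < (\<Sum>n<K. prob (box A n))"
proof -
  have "(\<lambda>K. \<Sum>n<K. prob {\<omega>\<in>space M. enat n < \<sigma> \<omega>}) \<longlonglongrightarrow> mean_stop"
    using mean_stop_sums by (simp add: sums_def)
  then have "\<forall>\<^sub>F K in sequentially. mean_stop - e < (\<Sum>n<K. prob {\<omega>\<in>space M. enat n < \<sigma> \<omega>})"
    by (rule order_tendstoD) (use assms in simp)
  then obtain K where K: "mean_stop - e < (\<Sum>n<K. prob {\<omega>\<in>space M. enat n < \<sigma> \<omega>})"
    using eventually_happens'[OF sequentially_bot] by blast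
  have "(\<lambda>k. \<Sum>n<K. prob (box (real k) n)) \<longlonglongrightarrow> (\<Sum>n<K. prob {\<omega>\<in>space M. enat n < \<sigma> \<omega>})"
    by (intro tendsto_sum prob_box_tendsto)
  then have "\<forall>\<^sub>F k in sequentially. mean_stop - e < (\<Sum>n<K. prob (box (real k) n))"
    by (rule order_tendstoD) (rule K)
  then obtain k where k: "mean_stop - e < (\<Sum>n<K. prob (box (real k) n))"
    using eventually_happens'[OF sequentially_bot] by blast
  have "\<forall>\<^sub>F A in at_top. mean_stop - e < (\<Sum>n<K. prob (box A n))"
    using eventually_ge_at_top[of "real k"]
  proof eventually_elim
    case (elim A)
    then have "(\<Sum>n<K. prob (box (real k) n)) \<le> (\<Sum>n<K. prob (box A n))"
      by (intro sum_mono finite_measure_mono box_mono) auto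
    with k show ?case by linarith
  qed
  then show ?thesis by blast
qed

text \<open>Long-tailedness concerns left shifts; evaluating it at \<open>c + x\<close> and
  inverting the ratio gives right shifts.\<close>

lemma tail_shift_tendsto:
  assumes "0 < c"
  shows "((\<lambda>x. T (x + c) / T x) \<longlongrightarrow> 1) at_top"
proof -
  have "((\<lambda>x. T (x - c) / T x) \<longlongrightarrow> 1) at_top"
    using lt assms by (auto simp: long_tailed_def)
  then have "((\<lambda>x. T (c + x - c) / T (c + x)) \<longlongrightarrow> 1) at_top"
    by (rule filterlim_compose[OF _ filterlim_tendsto_add_at_top[OF tendsto_const filterlim_ident]])
  then have "((\<lambda>x. inverse (T (c + x - c) / T (c + x))) \<longlongrightarrow> inverse 1) at_top"
    by (intro tendsto_intros) auto
  then show ?thesis by (simp add: add.commute)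
qed

text \<open>Divided by \<open>T x\<close>, the bound of \<open>conv_mid_le\<close> tends to
  \<open>int_tail A * mean_stop\<close> plus \<open>mean_neg_part\<close> times the share of
  \<open>mean_stop\<close> missed by the boxes. Each part is at most half of the allowance for large
  \<open>A\<close>.\<close>

lemma conv_mid_small:
  assumes p: "0 < prob {\<omega>\<in>space M. 0 < \<sigma> \<omega>}"
    and lim: "((\<lambda>x. prob (exceed x) / T x) \<longlongrightarrow> mean_stop) at_top"
    and e: "0 < e"
  shows "\<forall>\<^sub>F A in at_top. \<forall>\<^sub>F x in at_top. (LBINT y:{A..x-A}. T (x - y) * T y) \<le> e * T x"
proof -
  let ?p = "prob {\<omega>\<in>space M. 0 < \<sigma> \<omega>}"
  \<comment> \<open>The missed share that costs at most \<open>?p * e / 2\<close>; the added 1 keeps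
    the denominator positive.\<close>
  define d where "d = ?p * e / (2 * (mean_neg_part + 1))"
  have d: "0 < d" using p e mean_neg_part_nonneg by (simp add: d_def)
  have "mean_neg_part * d \<le> (mean_neg_part + 1) * d" using d by simp
  also have "\<dots> = ?p * e / 2" using mean_neg_part_nonneg by (simp add: d_def field_simps)
  finally have nd: "mean_neg_part * d \<le> ?p * e / 2" .
  obtain K where K: "\<forall>\<^sub>F A in at_top. mean_stop - d < (\<Sum>n<K. prob (box A n))"
    using eventually_box_mass[OF d] by blast
  have "((\<lambda>A. int_tail A * mean_stop) \<longlongrightarrow> 0 * mean_stop) at_top"
    by (intro tendsto_intros int_tail_tendsto)
  then have "\<forall>\<^sub>F A in at_top. int_tail A * mean_stop < ?p * e / 2"
    by (rule order_tendstoD) (use p e in simp)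
  with K eventually_gt_at_top[of 0] show ?thesis
  proof eventually_elim
    case (elim A)
    let ?s = "\<Sum>n<K. prob (box A n)"
    have "((\<lambda>x. int_tail A * (prob (exceed x) / T x) +
        mean_neg_part * (prob (exceed x) / T x - ?s * (T (x + A) / T x)))
      \<longlongrightarrow> int_tail A * mean_stop + mean_neg_part * (mean_stop - ?s * 1)) at_top"
      using elim by (intro tendsto_intros lim tail_shift_tendsto)
    moreover have "int_tail A * mean_stop + mean_neg_part * (mean_stop - ?s * 1) < ?p * e"
      using elim nd mult_left_mono[of "mean_stop - ?s" d mean_neg_part] mean_neg_part_nonneg by simp
    ultimately have "\<forall>\<^sub>F x in at_top. int_tail A * (prob (exceed x) / T x) +
        mean_neg_part * (prob (exceed x) / T x - ?s * (T (x + A) / T x)) < ?p * e"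
      by (rule order_tendstoD)
    with eventually_ge_at_top[of A] show ?case
    proof eventually_elim
      case x: (elim x)
      let ?c = "LBINT y:{A..x-A}. T (x - y) * T y"
      have "?p * ?c \<le> int_tail A * prob (exceed x) +
          mean_neg_part * (prob (exceed x) - ?s * T (x + A))"
        using elim x by (intro conv_mid_le) auto
      also have "\<dots> = (int_tail A * (prob (exceed x) / T x) +
        mean_neg_part * (prob (exceed x) / T x - ?s * (T (x + A) / T x))) * T x"
        using pos[of x] by (simp add: field_simps)
      also have "\<dots> \<le> (?p * e) * T x"
        using x(2) by (intro mult_right_mono) auto
      finally show ?case using p by (simp add: mult.assoc)
    qed
  qed
qed

end

section \<open>From the negligible middle to membership in \<open>S_star\<close>\<close>

theorem theorem1:
  fixes M :: "'a measure" and \<xi> :: "nat \<Rightarrow> 'a \<Rightarrow> real"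
    and F :: "real \<Rightarrow> real" and \<F> :: "nat \<Rightarrow> 'a set set" and \<sigma> :: "'a \<Rightarrow> enat"
  assumes P: "prob_space M"
    and meas: "\<And>n. \<xi> n \<in> borel_measurable M"
    and indep: "prob_space.indep_vars M (\<lambda>_. borel) \<xi> {1..}"
    and ident: "\<And>n. n \<ge> 1 \<Longrightarrow> distr M borel (\<xi> n) = distr M borel (\<xi> 1)"
    and F_def: "F = cdf (distr M borel (\<xi> 1))"
    and integ: "integrable M (\<xi> 1)"
    and neg_mean: "(\<integral>\<omega>. \<xi> 1 \<omega> \<partial>M) < 0"
    and lt: "long_tailed F"
    and filt: "admissible_filtration M \<xi> \<F>"
    and st: "is_stopping_time M \<F> \<sigma>"
    and pos: "measure M {\<omega>\<in>space M. \<sigma> \<omega> > 0} > 0"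
    and Sneg: "measure M {\<omega>\<in>space M. \<sigma> \<omega> \<noteq> \<infinity> \<and> psum \<xi> (the_enat (\<sigma> \<omega>)) \<omega> \<le> 0} = 1"
    and Efin: "(\<integral>\<^sup>+\<omega>. ennreal_of_enat (\<sigma> \<omega>) \<partial>M) < \<infinity>"
    and lim: "((\<lambda>x. measure M {\<omega>\<in>space M. maxsum \<xi> \<sigma> \<omega> > x} / tail F x)
               \<longlongrightarrow> enn2real (\<integral>\<^sup>+\<omega>. ennreal_of_enat (\<sigma> \<omega>) \<partial>M)) at_top"
  shows "S_star F"
proof -
  let ?E = "{\<omega>\<in>space M. \<sigma> \<omega> \<noteq> \<infinity> \<and> psum \<xi> (the_enat (\<sigma> \<omega>)) \<omega> \<le> 0}"
  interpret prob_space M by (rule P)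
  \<comment> \<open>Sets outside \<open>events\<close> have measure 0, so measure 1 forces
    measurability.\<close>
  have "?E \<in> events" using Sneg measure_notin_sets[of ?E M] by force
  then have AE: "AE \<omega> in M. \<sigma> \<omega> \<noteq> \<infinity> \<and> psum \<xi> (the_enat (\<sigma> \<omega>)) \<omega> \<le> 0"
    using prob_eq_1[of ?E] Sneg by auto
  interpret W: finite_mean_walk M \<xi> F \<F> \<sigma>
  proof
    show "AE \<omega> in M. \<forall>k. \<sigma> \<omega> = enat k \<longrightarrow> psum \<xi> k \<omega> \<le> 0"
      using AE by eventually_elim auto
  qed (fact meas ident F_def integ lt filt st Efin)+
  have "AE \<omega> in M. \<sigma> \<omega> \<noteq> \<infinity>" using AE by eventually_elim auto
  then have "((\<lambda>x. prob (W.exceed x) / tail F x) \<longlongrightarrow> W.mean_stop) at_top"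
    using lim by (simp add: W.prob_maxsum_gt)
  then have mid: "\<forall>\<^sub>F A in at_top. \<forall>\<^sub>F x in at_top.
      (LBINT y:{A..x-A}. tail F (x - y) * tail F y) \<le> e * tail F x" if "0 < e" for e
    using W.conv_mid_small that pos by blast
  let ?m = "LBINT t:{0..}. tail F t"
  have "((\<lambda>x. (LBINT y:{0..x}. tail F (x - y) * tail F y) / tail F x) \<longlongrightarrow> 2 * ?m) at_top"
    unfolding W.int_tail_def[symmetric]
    by (rule W.conv_asymp) (use lt mid in \<open>auto simp: long_tailed_def\<close>)
  then have "((\<lambda>x. (LBINT y:{0..x}. tail F (x - y) * tail F y) / tail F x / (2 * ?m)) \<longlongrightarrow> 2 * ?m / (2 * ?m)) at_top"
    using W.int_tail_pos by (intro tendsto_intros) (auto simp: W.int_tail_def)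
  \<comment> \<open>\<open>S_star\<close> uses an oriented interval integral, which for nonnegative
    \<open>x\<close> is the integral over the closed interval.\<close>
  moreover have "\<forall>\<^sub>F x in at_top. (LBINT y:{0..x}. tail F (x - y) * tail F y) / tail F x / (2 * ?m) =
      (LBINT y=0..x. tail F (x - y) * tail F y) / (2 * ?m * tail F x)"
    using eventually_ge_at_top[of 0]
    by eventually_elim (simp add: zero_ereal_def interval_integral_Icc mult.commute)
  ultimately have "((\<lambda>x. (LBINT y=0..x. tail F (x - y) * tail F y) / (2 * ?m * tail F x)) \<longlongrightarrow> 1) at_top"
    using W.int_tail_pos by (simp add: W.int_tail_def tendsto_cong)
  then show ?thesis
    unfolding S_star_def using W.pos W.int
    by (auto intro: asymp_equivI')
qed

end
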